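(* Let $\mathbf{V}=\mathbf{V}_{\mathrm{ok}}\uplus\mathbf{V}_{\mathrm{bad}}$ be a finite set of servers split into correct and faulty servers. Let $\{\mathcal{S}_v\}_{v\in\mathbf{V}_{\mathrm{ok}}}$ be a subjective federated Byzantine quorum system with quorum intersection and with at least one intact server, and let $\{\mathcal{Q}_v\}_{v\in\mathbf{V}_{\mathrm{ok}}}$ be the subjective quorum system it induces ($\mathcal{Q}_v$ is the set of quorums in $\mathcal{S}_v$). For each $v\in\mathbf{V}_{\mathrm{ok}}$ let $\mathcal{B}_v$ consist of the (inclusion-)maximal sets $B\subseteq\mathbf{V}$ such that the failure of $B$ leaves the set of intact servers in $\mathcal{S}_v$ non-empty (i.e. the set of intact servers in the FBQS $\mathcal{S}_v$ computed with set of faulty servers $B$ is non-empty). Then $(\{\mathcal{Q}_v\}_{v\in\mathbf{V}_{\mathrm{ok}}},\{\mathcal{B}_v\}_{v\in\mathbf{V}_{\mathrm{ok}}})$ is a subjective dissemination quorum system.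
   Context: Federated Byzantine quorum system (FBQS) over $\mathbf{V}$: a function $\mathcal{S}$ assigning to each $v\in\mathbf{V}$ a non-empty set $\mathcal{S}(v)\subseteq 2^{\mathbf{V}}$ of quorum slices, with $v\in q$ for all $q\in\mathcal{S}(v)$. A non-empty $U\subseteq\mathbf{V}$ is a quorum in $\mathcal{S}$ if $\forall v\in U.\ \exists q\in\mathcal{S}(v).\ q\subseteq U$. $\mathcal{S}$ has quorum intersection if any two of its quorums intersect. For $I\subseteq\mathbf{V}$, $\mathcal{S}|_I$ is the FBQS over universe $I$ with $\mathcal{S}|_I(v)=\{q\cap I\mid q\in\mathcal{S}(v)\}$. Given a set $F\subseteq\mathbf{V}$ of faulty servers, the set of intact servers in $\mathcal{S}$ is the biggest set $I$ such that $I\cap F=\emptyset$; if $I$ is non-empty then it is a quorum in $\mathcal{S}$; and $\mathcal{S}|_I$ has quorum intersection. (For FBQSes with quorum intersection this set exists and is unique.) Subjective FBQS: a family $\{\mathcal{S}_v\}_{v\in\mathbf{V}_{\mathrm{ok}}}$ of FBQSes over $\mathbf{V}$ such that $\mathcal{S}_{v_1}(v)=\mathcal{S}_{v_2}(v)$ for all $v_1,v_2,v\in\mathbf{V}_{\mathrm{ok}}$. It has quorum intersection if every $\mathcal{S}_v$ does. The set of intact servers in the subjective FBQS is the biggest set $\mathbf{V}_{\mathrm{int}}$ such that $\mathbf{V}_{\mathrm{int}}\cap\mathbf{V}_{\mathrm{bad}}=\emptyset$; if $\mathbf{V}_{\mathrm{int}}$ is non-empty then it is a quorum in $\mathcal{S}_v$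 for each $v\in\mathbf{V}_{\mathrm{ok}}$; and $\mathcal{S}_v|_{\mathbf{V}_{\mathrm{int}}}$ has quorum intersection for each $v\in\mathbf{V}_{\mathrm{ok}}$. A quorum system is a non-empty set $\mathcal{Q}\subseteq 2^{\mathbf{V}}$ such that every $U\in\mathcal{Q}$ is non-empty, any two $U_1,U_2\in\mathcal{Q}$ intersect, and $\mathcal{Q}$ is closed under binary union. A fail-prone system is a non-empty set $\mathcal{B}\subseteq 2^{\mathbf{V}}$ none of whose elements is contained in another. A subjective Byzantine quorum system is a pair $(\{\mathcal{Q}_v\}_{v\in\mathbf{V}_{\mathrm{ok}}},\{\mathcal{B}_v\}_{v\in\mathbf{V}_{\mathrm{ok}}})$ where each $\mathcal{Q}_v$ is a quorum system and each $\mathcal{B}_v$ a fail-prone system. It is a subjective dissemination quorum system (subjective DQS) when the following hold. SD-safety: $\forall v\in\mathbf{V}_{\mathrm{ok}}.\ \exists B\in\mathcal{B}_v.\ \mathbf{V}_{\mathrm{bad}}\subseteq B$. SD-consistency: $\forall v\in\mathbf{V}_{\mathrm{ok}}.\ \forall U_1\in\mathcal{Q}_v.\ \forall U_2\in\bigcup_{v'\in\mathbf{V}_{\mathrm{ok}}}\mathcal{Q}_{v'}.\ \forall B\in\mathcal{B}_v.\ \mathbf{V}_{\mathrm{bad}}\subseteq B\implies U_1\cap U_2\not\subseteq B$. SD-availability: $\forall v\in\mathbf{V}_{\mathrm{ok}}.\ \forall B\in\mathcal{B}_v.\ \exists U\in\mathcal{Q}_v.\ U\cap B=\emptyset$. 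*)

theory Defs
  imports Main
begin

text \<open>
  The universe of servers is a set \<open>V\<close>, passed explicitly. An FBQS over \<open>V\<close> is a function on the
  whole type of which only the values on \<open>V\<close> are meaningful; likewise only the members with index in
  \<open>Vok\<close> of a subjective family are meaningful.
\<close>

definition fbqs :: "'a set \<Rightarrow> ('a \<Rightarrow> 'a set set) \<Rightarrow> bool" where
  "fbqs V S \<longleftrightarrow> (\<forall>v\<in>V. S v \<noteq> {} \<and> S v \<subseteq> Pow V \<and> (\<forall>q\<in>S v. v \<in> q))"

definition quorum :: "'a set \<Rightarrow> ('a \<Rightarrow> 'a set set) \<Rightarrow> 'a set \<Rightarrow> bool" where
  "quorum V S U \<longleftrightarrow> U \<noteq> {} \<and> U \<subseteq> V \<and> (\<forall>v\<in>U. \<exists>q\<in>S v. q \<subseteq> U)"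

definition quorum_intersection :: "'a set \<Rightarrow> ('a \<Rightarrow> 'a set set) \<Rightarrow> bool" where
  "quorum_intersection V S \<longleftrightarrow>
     (\<forall>U1 U2. quorum V S U1 \<and> quorum V S U2 \<longrightarrow> U1 \<inter> U2 \<noteq> {})"

definition fbqs_restrict :: "('a \<Rightarrow> 'a set set) \<Rightarrow> 'a set \<Rightarrow> 'a \<Rightarrow> 'a set set" where
  "fbqs_restrict S I v = {q \<inter> I | q. q \<in> S v}"

text \<open>
  ``Biggest'' is meant with respect to inclusion. The lemmas \<open>intact_exists\<close> and
  \<open>subjective_intact_exists\<close> below show that, for systems with quorum intersection, the
  \<^const>\<open>Greatest\<close> elements in the next two definitions exist.
\<close>

definition intact :: "'a set \<Rightarrow> ('a \<Rightarrow> 'a set set) \<Rightarrow> 'a set \<Rightarrow> 'a set" where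
  "intact V S F = (GREATEST I. I \<subseteq> V \<and> I \<inter> F = {} \<and>
     (I \<noteq> {} \<longrightarrow> quorum V S I) \<and>
     quorum_intersection I (fbqs_restrict S I))"

definition subjective_fbqs :: "'a set \<Rightarrow> 'a set \<Rightarrow> ('a \<Rightarrow> 'a \<Rightarrow> 'a set set) \<Rightarrow> bool" where
  "subjective_fbqs V Vok S \<longleftrightarrow>
     (\<forall>v\<in>Vok. fbqs V (S v)) \<and>
     (\<forall>v1\<in>Vok. \<forall>v2\<in>Vok. \<forall>v\<in>Vok. S v1 v = S v2 v)"

definition subjective_quorum_intersection ::
    "'a set \<Rightarrow> 'a set \<Rightarrow> ('a \<Rightarrow> 'a \<Rightarrow> 'a set set) \<Rightarrow> bool" where
  "subjective_quorum_intersection V Vok S \<longleftrightarrow> (\<forall>v\<in>Vok. quorum_intersection V (S v))"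

definition subjective_intact ::
    "'a set \<Rightarrow> 'a set \<Rightarrow> 'a set \<Rightarrow> ('a \<Rightarrow> 'a \<Rightarrow> 'a set set) \<Rightarrow> 'a set" where
  "subjective_intact V Vok Vbad S = (GREATEST I. I \<subseteq> V \<and> I \<inter> Vbad = {} \<and>
     (I \<noteq> {} \<longrightarrow> (\<forall>v\<in>Vok. quorum V (S v) I)) \<and>
     (\<forall>v\<in>Vok. quorum_intersection I (fbqs_restrict (S v) I)))"

definition quorum_system :: "'a set \<Rightarrow> 'a set set \<Rightarrow> bool" where
  "quorum_system V Q \<longleftrightarrow> Q \<noteq> {} \<and> Q \<subseteq> Pow V \<and> {} \<notin> Q \<and>
     (\<forall>U1\<in>Q. \<forall>U2\<in>Q. U1 \<inter> U2 \<noteq> {}) \<and>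
     (\<forall>U1\<in>Q. \<forall>U2\<in>Q. U1 \<union> U2 \<in> Q)"

definition fail_prone_system :: "'a set \<Rightarrow> 'a set set \<Rightarrow> bool" where
  "fail_prone_system V \<B> \<longleftrightarrow> \<B> \<noteq> {} \<and> \<B> \<subseteq> Pow V \<and>
     (\<forall>B1\<in>\<B>. \<forall>B2\<in>\<B>. B1 \<subseteq> B2 \<longrightarrow> B1 = B2)"

definition subjective_bqs ::
    "'a set \<Rightarrow> 'a set \<Rightarrow> ('a \<Rightarrow> 'a set set) \<Rightarrow> ('a \<Rightarrow> 'a set set) \<Rightarrow> bool" where
  "subjective_bqs V Vok Q \<B> \<longleftrightarrow>
     (\<forall>v\<in>Vok. quorum_system V (Q v) \<and> fail_prone_system V (\<B> v))"

definition sd_safety :: "'a set \<Rightarrow> 'a set \<Rightarrow> ('a \<Rightarrow> 'a set set) \<Rightarrow> bool" where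
  "sd_safety Vok Vbad \<B> \<longleftrightarrow> (\<forall>v\<in>Vok. \<exists>B\<in>\<B> v. Vbad \<subseteq> B)"

definition sd_consistency ::
    "'a set \<Rightarrow> 'a set \<Rightarrow> ('a \<Rightarrow> 'a set set) \<Rightarrow> ('a \<Rightarrow> 'a set set) \<Rightarrow> bool" where
  "sd_consistency Vok Vbad Q \<B> \<longleftrightarrow>
     (\<forall>v\<in>Vok. \<forall>U1\<in>Q v. \<forall>U2\<in>(\<Union>v'\<in>Vok. Q v'). \<forall>B\<in>\<B> v.
        Vbad \<subseteq> B \<longrightarrow> \<not> U1 \<inter> U2 \<subseteq> B)"

definition sd_availability ::
    "'a set \<Rightarrow> ('a \<Rightarrow> 'a set set) \<Rightarrow> ('a \<Rightarrow> 'a set set) \<Rightarrow> bool" where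
  "sd_availability Vok Q \<B> \<longleftrightarrow> (\<forall>v\<in>Vok. \<forall>B\<in>\<B> v. \<exists>U\<in>Q v. U \<inter> B = {})"

definition subjective_dqs ::
    "'a set \<Rightarrow> 'a set \<Rightarrow> 'a set \<Rightarrow> ('a \<Rightarrow> 'a set set) \<Rightarrow> ('a \<Rightarrow> 'a set set) \<Rightarrow> bool" where
  "subjective_dqs V Vok Vbad Q \<B> \<longleftrightarrow> subjective_bqs V Vok Q \<B> \<and>
     sd_safety Vok Vbad \<B> \<and> sd_consistency Vok Vbad Q \<B> \<and> sd_availability Vok Q \<B>"

definition induced_quorums :: "'a set \<Rightarrow> ('a \<Rightarrow> 'a set set) \<Rightarrow> 'a set set" where
  "induced_quorums V S = {U. quorum V S U}"

definition induced_fail_prone :: "'a set \<Rightarrow> ('a \<Rightarrow> 'a set set) \<Rightarrow> 'a set set" where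
  "induced_fail_prone V S = {B. B \<subseteq> V \<and> intact V S B \<noteq> {} \<and>
     (\<forall>B'. B' \<subseteq> V \<and> intact V S B' \<noteq> {} \<and> B \<subseteq> B' \<longrightarrow> B' = B)}"

lemma quorum_restrict_Int:
  assumes "quorum J (fbqs_restrict S J) U" "I \<subseteq> J" "U \<inter> I \<noteq> {}"
  shows "quorum I (fbqs_restrict S I) (U \<inter> I)"
  unfolding quorum_def
proof (intro conjI ballI)
  fix v assume "v \<in> U \<inter> I"
  then obtain q where "q \<in> S v" "q \<inter> J \<subseteq> U"
    using assms(1) unfolding quorum_def fbqs_restrict_def by blast
  then have "q \<inter> I \<in> fbqs_restrict S I v" "q \<inter> I \<subseteq> U \<inter> I"
    using assms(2) unfolding fbqs_restrict_def by blast+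
  then show "\<exists>q\<in>fbqs_restrict S I v. q \<subseteq> U \<inter> I" by blast
qed (use assms in auto)

lemma quorum_Int_restrict:
  assumes "quorum V S U" "U \<inter> I \<noteq> {}"
  shows "quorum I (fbqs_restrict S I) (U \<inter> I)"
  unfolding quorum_def
proof (intro conjI ballI)
  fix v assume "v \<in> U \<inter> I"
  then obtain q where "q \<in> S v" "q \<subseteq> U" using assms(1) unfolding quorum_def by blast
  then have "q \<inter> I \<in> fbqs_restrict S I v" "q \<inter> I \<subseteq> U \<inter> I"
    unfolding fbqs_restrict_def by blast+
  then show "\<exists>q\<in>fbqs_restrict S I v. q \<subseteq> U \<inter> I" by blast
qed (use assms in auto)

lemma quorum_Un: "quorum V S I1 \<Longrightarrow> quorum V S I2 \<Longrightarrow> quorum V S (I1 \<union> I2)"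
  unfolding quorum_def by (metis Un_iff Un_subset_iff le_sup_iff sup_eq_bot_iff sup.coboundedI1 sup.coboundedI2)

lemma quorum_intersection_restrict_Un:
  assumes qi: "quorum_intersection V S"
    and I1: "quorum V S I1" "quorum_intersection I1 (fbqs_restrict S I1)"
    and I2: "quorum V S I2" "quorum_intersection I2 (fbqs_restrict S I2)"
  shows "quorum_intersection (I1 \<union> I2) (fbqs_restrict S (I1 \<union> I2))"
  unfolding quorum_intersection_def
proof (intro allI impI, elim conjE)
  have ne: "I1 \<inter> I2 \<noteq> {}" using qi I1(1) I2(1) unfolding quorum_intersection_def by blast
  have q12: "quorum I1 (fbqs_restrict S I1) (I2 \<inter> I1)"
    using quorum_Int_restrict[OF I2(1)] ne by blast
  have meets: "U \<inter> I2 \<noteq> {}" if U: "quorum (I1 \<union> I2) (fbqs_restrict S (I1 \<union> I2)) U" for U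
  proof (cases "U \<inter> I1 = {}")
    case True
    then show ?thesis using U unfolding quorum_def by blast
  next
    case False
    then have "quorum I1 (fbqs_restrict S I1) (U \<inter> I1)" using quorum_restrict_Int[OF U] by blast
    then show ?thesis using q12 I1(2) unfolding quorum_intersection_def by blast
  qed
  fix U1 U2
  assume U: "quorum (I1 \<union> I2) (fbqs_restrict S (I1 \<union> I2)) U1"
    "quorum (I1 \<union> I2) (fbqs_restrict S (I1 \<union> I2)) U2"
  have "quorum I2 (fbqs_restrict S I2) (U1 \<inter> I2)" "quorum I2 (fbqs_restrict S I2) (U2 \<inter> I2)"
    using quorum_restrict_Int[OF U(1) Un_upper2 meets[OF U(1)]]
      quorum_restrict_Int[OF U(2) Un_upper2 meets[OF U(2)]] .
  then show "U1 \<inter> U2 \<noteq> {}" using I2(2) unfolding quorum_intersection_def by blast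
qed

lemma greatest_set_exists:
  fixes P :: "'a set \<Rightarrow> bool"
  assumes fin: "finite V" and sub: "\<And>I. P I \<Longrightarrow> I \<subseteq> V" and emp: "P {}"
    and un: "\<And>I J. P I \<Longrightarrow> P J \<Longrightarrow> P (I \<union> J)"
  shows "\<exists>I. P I \<and> (\<forall>J. P J \<longrightarrow> J \<subseteq> I)"
proof -
  have "finite {I. P I}" using fin sub by (metis Collect_mono finite_Collect_subsets finite_subset)
  then obtain M where M: "P M" "\<And>J. P J \<Longrightarrow> M \<subseteq> J \<Longrightarrow> J = M"
    using finite_has_maximal[of "{I. P I}"] emp by auto
  then have "J \<subseteq> M" if "P J" for J using un[OF M(1) that] by blast
  then show ?thesis using M(1) by blast
qed

lemma subjective_intact_exists:
  assumes "finite V" "subjective_quorum_intersection V Vok S"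
  shows "\<exists>I. (I \<subseteq> V \<and> I \<inter> Vbad = {} \<and> (I \<noteq> {} \<longrightarrow> (\<forall>v\<in>Vok. quorum V (S v) I)) \<and>
           (\<forall>v\<in>Vok. quorum_intersection I (fbqs_restrict (S v) I))) \<and>
         (\<forall>J. J \<subseteq> V \<and> J \<inter> Vbad = {} \<and> (J \<noteq> {} \<longrightarrow> (\<forall>v\<in>Vok. quorum V (S v) J)) \<and>
           (\<forall>v\<in>Vok. quorum_intersection J (fbqs_restrict (S v) J)) \<longrightarrow> J \<subseteq> I)"
    (is "\<exists>I. ?P I \<and> (\<forall>J. ?P J \<longrightarrow> J \<subseteq> I)")
proof (rule greatest_set_exists[OF assms(1)])
  show "?P {}" by (auto simp: quorum_intersection_def quorum_def)
  fix I J assume I: "?P I" and J: "?P J"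
  show "?P (I \<union> J)"
  proof (cases "I = {} \<or> J = {}")
    case True
    then show ?thesis using I J by auto
  next
    case False
    then have "quorum V (S v) (I \<union> J)"
      "quorum_intersection (I \<union> J) (fbqs_restrict (S v) (I \<union> J))" if "v \<in> Vok" for v
      using I J that assms(2) quorum_Un[of V "S v" I J]
        quorum_intersection_restrict_Un[of V "S v" I J]
      unfolding subjective_quorum_intersection_def by blast+
    then show ?thesis using I J by blast
  qed
qed blast

lemma intact_exists:
  assumes "finite V" "quorum_intersection V S"
  shows "\<exists>I. (I \<subseteq> V \<and> I \<inter> F = {} \<and> (I \<noteq> {} \<longrightarrow> quorum V S I) \<and>
           quorum_intersection I (fbqs_restrict S I)) \<and>
         (\<forall>J. J \<subseteq> V \<and> J \<inter> F = {} \<and> (J \<noteq> {} \<longrightarrow> quorum V S J) \<and>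
           quorum_intersection J (fbqs_restrict S J) \<longrightarrow> J \<subseteq> I)"
  using subjective_intact_exists[of V "{undefined}" "\<lambda>_. S" F] assms
  by (simp add: subjective_quorum_intersection_def)

end

theory Submission
  imports Defs
begin

text \<open>
  The crux is SD-consistency. A set \<open>B\<close> containing all faulty servers leaves an intact set \<open>I\<close> of
  correct servers only, and on these all the views agree; so \<open>I\<close> is a quorum in every view and the
  restrictions of all views to \<open>I\<close> have the same quorums. Two quorums from different views both meet
  \<open>I\<close>, and their traces on \<open>I\<close> are quorums of one restricted system with quorum intersection. Hence
  they share a member of \<open>I\<close>, which lies outside \<open>B\<close>.
\<close>

text \<open>Being a quorum depends only on the slices of the members of \<open>U\<close>. This
  carries quorums from one view to another although the views may differ on faulty servers.\<close>

lemma quorum_cong: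
  assumes "\<And>u. u \<in> U \<Longrightarrow> S u = S' u"
  shows "quorum V S U \<longleftrightarrow> quorum V S' U"
  using assms unfolding quorum_def by auto

lemma fbqs_restrict_cong: "S u = S' u \<Longrightarrow> fbqs_restrict S I u = fbqs_restrict S' I u"
  unfolding fbqs_restrict_def by simp

text \<open>\<open>GREATEST\<close> is informative only when a greatest element exists.
  \<open>intact_exists\<close> supplies one, so \<open>intact V S F\<close> inherits the defining
  conditions.\<close>

lemma intact_props:
  assumes "finite V" "quorum_intersection V S"
  shows "intact V S F \<subseteq> V" "intact V S F \<inter> F = {}"
    and "intact V S F \<noteq> {} \<Longrightarrow> quorum V S (intact V S F)"
    and "quorum_intersection (intact V S F) (fbqs_restrict S (intact V S F))"
proof -
  let ?P = "\<lambda>I. I \<subseteq> V \<and> I \<inter> F = {} \<and> (I \<noteq> {} \<longrightarrow> quorum V S I) \<and>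
    quorum_intersection I (fbqs_restrict S I)"
  obtain I where "?P I" "\<forall>J. ?P J \<longrightarrow> J \<subseteq> I"
    using intact_exists[OF assms, of F] by (elim exE) (erule conjE)
  moreover from this have "intact V S F = I"
    unfolding intact_def by (intro Greatest_equality[where P = ?P]) blast+
  ultimately have "?P (intact V S F)" by (elim ssubst)
  then show "intact V S F \<subseteq> V" "intact V S F \<inter> F = {}"
    "intact V S F \<noteq> {} \<Longrightarrow> quorum V S (intact V S F)"
    "quorum_intersection (intact V S F) (fbqs_restrict S (intact V S F))"
    by simp_all
qed

text \<open>The maximality half of the definition; it serves to show that an intact set is non-empty
  by placing a quorum inside it.\<close>

lemma intact_upper:
  assumes "finite V" "quorum_intersection V S"
    and J: "quorum V S J" "J \<inter> F = {}" "quorum_intersection J (fbqs_restrict S J)"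
  shows "J \<subseteq> intact V S F"
proof -
  let ?P = "\<lambda>I. I \<subseteq> V \<and> I \<inter> F = {} \<and> (I \<noteq> {} \<longrightarrow> quorum V S I) \<and>
    quorum_intersection I (fbqs_restrict S I)"
  obtain I where I: "?P I" "\<forall>J. ?P J \<longrightarrow> J \<subseteq> I"
    using intact_exists[OF assms(1,2), of F] by (elim exE) (erule conjE)
  have "intact V S F = I"
    unfolding intact_def by (intro Greatest_equality[where P = ?P]) (use I in simp_all)
  moreover have "?P J" using J unfolding quorum_def by blast
  ultimately show ?thesis using I(2) by blast
qed

lemma subjective_intact_props:
  assumes "finite V" "subjective_quorum_intersection V Vok S"
    and ne: "subjective_intact V Vok Vbad S \<noteq> {}" and v: "v \<in> Vok"
  shows "subjective_intact V Vok Vbad S \<inter> Vbad = {}"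
    and "quorum V (S v) (subjective_intact V Vok Vbad S)"
    and "quorum_intersection (subjective_intact V Vok Vbad S)
           (fbqs_restrict (S v) (subjective_intact V Vok Vbad S))"
proof -
  let ?P = "\<lambda>I. I \<subseteq> V \<and> I \<inter> Vbad = {} \<and> (I \<noteq> {} \<longrightarrow> (\<forall>v\<in>Vok. quorum V (S v) I)) \<and>
    (\<forall>v\<in>Vok. quorum_intersection I (fbqs_restrict (S v) I))"
  obtain I where "?P I" "\<forall>J. ?P J \<longrightarrow> J \<subseteq> I"
    using subjective_intact_exists[OF assms(1,2), of Vbad] by (elim exE) (erule conjE)
  moreover from this have "subjective_intact V Vok Vbad S = I"
    unfolding subjective_intact_def by (intro Greatest_equality[where P = ?P]) blast+
  ultimately have "?P (subjective_intact V Vok Vbad S)" by (elim ssubst)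
  then show "subjective_intact V Vok Vbad S \<inter> Vbad = {}"
    "quorum V (S v) (subjective_intact V Vok Vbad S)"
    "quorum_intersection (subjective_intact V Vok Vbad S)
       (fbqs_restrict (S v) (subjective_intact V Vok Vbad S))"
    using ne v by simp_all
qed

text \<open>The subjective intact set meets, in each single view, the conditions that define the
  intact set for \<open>Vbad\<close>, so it lies inside that set.\<close>

lemma intact_subjective_nonempty:
  assumes "finite V" "subjective_quorum_intersection V Vok S"
    and "subjective_intact V Vok Vbad S \<noteq> {}" "v \<in> Vok"
  shows "intact V (S v) Vbad \<noteq> {}"
proof -
  have "quorum_intersection V (S v)"
    using assms(2,4) unfolding subjective_quorum_intersection_def by blast
  then show ?thesis
    using intact_upper[of V "S v"] subjective_intact_props[OF assms] assms(1,3) by blast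
qed

text \<open>\<open>U\<close> is the witness that the family is non-empty; in the theorem it is the
  subjective intact set.\<close>

lemma quorum_system_induced_quorums:
  assumes "quorum_intersection V S" "quorum V S U"
  shows "quorum_system V (induced_quorums V S)"
proof -
  have "U1 \<inter> U2 \<noteq> {}" if "quorum V S U1" "quorum V S U2" for U1 U2
    using that assms(1) unfolding quorum_intersection_def by blast
  moreover have "U' \<noteq> {}" "U' \<subseteq> V" if "quorum V S U'" for U'
    using that unfolding quorum_def by blast+
  ultimately show ?thesis
    using assms(2) quorum_Un unfolding quorum_system_def induced_quorums_def by blast
qed

lemma induced_fail_prone_above:
  assumes "finite V" "F \<subseteq> V" "intact V S F \<noteq> {}"
  shows "\<exists>B\<in>induced_fail_prone V S. F \<subseteq> B"
proof -
  let ?A = "{B. B \<subseteq> V \<and> intact V S B \<noteq> {}}"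
  have "finite ?A" using assms(1) by simp
  \<comment> \<open>In a finite family every member, here \<open>F\<close>, lies below a maximal
    one.\<close>
  then obtain B where "B \<in> ?A" "F \<subseteq> B" "\<forall>B'\<in>?A. B \<subseteq> B' \<longrightarrow> B = B'"
    using finite_has_maximal2[of ?A F] assms(2,3) by blast
  then have "B \<in> induced_fail_prone V S" unfolding induced_fail_prone_def by auto
  then show ?thesis using \<open>F \<subseteq> B\<close> by blast
qed

lemma fail_prone_system_induced_fail_prone:
  assumes "induced_fail_prone V S \<noteq> {}"
  shows "fail_prone_system V (induced_fail_prone V S)"
  using assms unfolding fail_prone_system_def induced_fail_prone_def by blast

text \<open>The condition on \<open>B\<close> concerns \<open>S\<close> alone: in SD-consistency
  \<open>B\<close> is fail-prone for the view of \<open>U1\<close>, and the view of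
  \<open>U2\<close> may judge it differently.\<close>

lemma quorums_meet_outside:
  assumes "finite V" "Vbad \<subseteq> B"
    and qi: "quorum_intersection V S" "quorum_intersection V S'"
    and agree: "\<And>u. u \<in> V - Vbad \<Longrightarrow> S u = S' u"
    and U: "quorum V S U1" "quorum V S' U2"
    and ne: "intact V S B \<noteq> {}"
  shows "\<not> U1 \<inter> U2 \<subseteq> B"
proof -
  define I where "I = intact V S B"
  note I = intact_props[OF assms(1) qi(1), of B, folded I_def]
  \<comment> \<open>\<open>I\<close> avoids \<open>B\<close> and hence \<open>Vbad\<close>, so all
    its members are correct.\<close>
  have ag: "S u = S' u" if "u \<in> I" for u using that agree I(1,2) assms(2) by blast
  have IS: "quorum V S I" using I(3) ne I_def by simp
  moreover have "quorum V S' I" using IS quorum_cong[of I S S'] ag by blast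
  ultimately have "U1 \<inter> I \<noteq> {}" "U2 \<inter> I \<noteq> {}"
    using qi U unfolding quorum_intersection_def by blast+
  then have "quorum I (fbqs_restrict S I) (U1 \<inter> I)" "quorum I (fbqs_restrict S' I) (U2 \<inter> I)"
    using quorum_Int_restrict[OF U(1)] quorum_Int_restrict[OF U(2)] by simp_all
  \<comment> \<open>The trace of \<open>U2\<close> lies in \<open>I\<close>, where both views assign
    the same slices, so it can be compared with the trace of \<open>U1\<close> in one restricted
    system.\<close>
  moreover have "quorum I (fbqs_restrict S I) (U2 \<inter> I) \<longleftrightarrow> quorum I (fbqs_restrict S' I) (U2 \<inter> I)"
    by (intro quorum_cong fbqs_restrict_cong ag) blast
  ultimately have "(U1 \<inter> I) \<inter> (U2 \<inter> I) \<noteq> {}"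
    using I(4) unfolding quorum_intersection_def by blast
  then show ?thesis using I(2) by blast
qed

theorem theorem25:
  fixes V Vok Vbad :: "'a set"
    and S :: "'a \<Rightarrow> 'a \<Rightarrow> 'a set set"
  assumes "finite V"
    and "V = Vok \<union> Vbad"
    and "Vok \<inter> Vbad = {}"
    and "subjective_fbqs V Vok S"
    and "subjective_quorum_intersection V Vok S"
    and "subjective_intact V Vok Vbad S \<noteq> {}"
  shows "subjective_dqs V Vok Vbad
           (\<lambda>v. induced_quorums V (S v)) (\<lambda>v. induced_fail_prone V (S v))"
proof -
  have qi: "quorum_intersection V (S v)" if "v \<in> Vok" for v
    using that assms(5) unfolding subjective_quorum_intersection_def by blast
  \<comment> \<open>\<open>Vbad\<close> itself leaves an intact server in each view, so it extends
    to a maximal such set. This gives SD-safety and also that the fail-prone family is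
    non-empty.\<close>
  have safe: "\<exists>B\<in>induced_fail_prone V (S v). Vbad \<subseteq> B" if "v \<in> Vok" for v
    using induced_fail_prone_above[of V Vbad "S v"]
      intact_subjective_nonempty[OF assms(1,5,6) that] assms(1,2) by blast
  have ne: "intact V (S v) B \<noteq> {}" if "B \<in> induced_fail_prone V (S v)" for v B
    using that unfolding induced_fail_prone_def by blast
  have "subjective_bqs V Vok (\<lambda>v. induced_quorums V (S v)) (\<lambda>v. induced_fail_prone V (S v))"
    unfolding subjective_bqs_def
  proof (intro ballI conjI)
    fix v assume v: "v \<in> Vok"
    show "quorum_system V (induced_quorums V (S v))"
      using quorum_system_induced_quorums[OF qi[OF v]]
        subjective_intact_props(2)[OF assms(1,5,6) v] by blast
    show "fail_prone_system V (induced_fail_prone V (S v))"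
      using fail_prone_system_induced_fail_prone safe[OF v] by blast
  qed
  moreover have "sd_safety Vok Vbad (\<lambda>v. induced_fail_prone V (S v))"
    using safe unfolding sd_safety_def by blast
  moreover have "sd_consistency Vok Vbad (\<lambda>v. induced_quorums V (S v))
      (\<lambda>v. induced_fail_prone V (S v))"
    unfolding sd_consistency_def
  proof (intro ballI impI)
    fix v U1 U2 B
    assume v: "v \<in> Vok" and U1: "U1 \<in> induced_quorums V (S v)"
      and U2: "U2 \<in> (\<Union>v'\<in>Vok. induced_quorums V (S v'))"
      and B: "B \<in> induced_fail_prone V (S v)" "Vbad \<subseteq> B"
    obtain v' where v': "v' \<in> Vok" "quorum V (S v') U2"
      using U2 unfolding induced_quorums_def by blast
    have "S v u = S v' u" if "u \<in> V - Vbad" for u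
      using assms(2,4) v v'(1) that unfolding subjective_fbqs_def by blast
    then show "\<not> U1 \<inter> U2 \<subseteq> B"
      using quorums_meet_outside[OF assms(1) B(2) qi[OF v] qi[OF v'(1)] _ _ v'(2) ne[OF B(1)]]
        U1 unfolding induced_quorums_def by blast
  qed
  moreover have "sd_availability Vok (\<lambda>v. induced_quorums V (S v))
      (\<lambda>v. induced_fail_prone V (S v))"
    unfolding sd_availability_def
  proof (intro ballI)
    fix v B assume v: "v \<in> Vok" and B: "B \<in> induced_fail_prone V (S v)"
    note I = intact_props(2,3)[OF assms(1) qi[OF v], of B]
    \<comment> \<open>The quorum avoiding \<open>B\<close> is the intact set that \<open>B\<close>
      leaves.\<close>
    have "intact V (S v) B \<in> induced_quorums V (S v)"
      using I(2) ne[OF B] unfolding induced_quorums_def by simp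
    then show "\<exists>U\<in>induced_quorums V (S v). U \<inter> B = {}"
      using I(1) by blast
  qed
  ultimately show ?thesis unfolding subjective_dqs_def by blast
qed

end
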